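(* Suppose $P\neq NP$. Then there is an instance of the integral routing model (strategy spaces $X_i'=X_i\cap\mathbb{Z}^m_+$) with only two players having different source-sink pairs $(s_i,t_i)$, $i\in\{1,2\}$, and non-decreasing, identical, linear capped bandwidth utilities $U_1=U_2$, for which there is a vector $u\in\mathbb{Z}^m_+$ that is not weakly enforceable with market clearing prices.
   Context: An instance consists of a directed graph $G=(V,E)$ with $|E|=m$, players $i\in N$ with source-sink pairs $(s_i,t_i)\in V\times V$, and utility functions $U_i$. The flow polyhedron of player $i$ is $X_i=\{x_i\in\mathbb{R}^m_+:\sum_{j\in\delta^+(v)}x_{ij}-\sum_{j\in\delta^-(v)}x_{ij}=0\ \text{for all }v\in V\setminus\{s_i,t_i\}\}$, where $\delta^+(v),\delta^-(v)$ are the arcs leaving and entering $v$, and $\mathrm{val}(x_i)=\sum_{j\in\delta^+(s_i)}x_{ij}-\sum_{j\in\delta^-(s_i)}x_{ij}$. A capped linear function $f:\mathbb{R}\to\mathbb{R}$ has the form $f(z)=az$ for $z\le z^{\max}$ and $f(z)=az^{\max}$ for $z\ge z^{\max}$. Let $\ell(x)=\sum_{i\in N}x_i$. $u$ is weakly enforceable with market clearing prices if there are $x^*\in\prod_{i\in N}X_i'$ and $\lambda\in\mathbb{R}^m_+$ such that $\ell(x^* )\le u$, $\ell_j(x^* )<u_j\Rightarrow\lambda_j=0$ for all $j\in E$, and $x_i^*\in\arg\max\{U_i(\mathrm{val}(x_i))-\lambda^\intercal x_i:x_i\in X_i'\}$ for all $i\in N$. *)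

theory Defs
  imports Complex_Main "HOL-Library.FuncSet" "HOL-Computational_Algebra.Polynomial"
    "Graph_Theory.Digraph"
begin

section \<open>The complexity classes P and NP\<close>

text \<open>
  One-tape Turing machines on a two-way infinite tape. A machine is its transition relation: the
  entry \<open>(q, a, q', b, d)\<close> allows a machine that is in state \<open>q\<close> and reads \<open>a\<close> to write \<open>b\<close>,
  move the head according to \<open>d\<close> and enter state \<open>q'\<close>. Finitely many transitions mean finitely many
  relevant states and tape symbols. State 0 is the start state and state 1 the accepting
  state; symbol 0 is the blank, and the symbols 1 and 2 encode the input bits.
\<close>

datatype move = Left | Stay | Right

fun offset :: "move \<Rightarrow> int" where
  "offset Left = -1"
| "offset Stay = 0"
| "offset Right = 1"

type_synonym tm = "(nat \<times> nat \<times> nat \<times> nat \<times> move) set"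

type_synonym config = "nat \<times> (int \<Rightarrow> nat) \<times> int"  \<comment> \<open>state, tape, head position\<close>

definition step :: "tm \<Rightarrow> (config \<times> config) set" where
  "step M = {((q, T, h), (q', T(h := b), h + offset d)) | q T h q' b d. (q, T h, q', b, d) \<in> M}"

definition initial :: "bool list \<Rightarrow> config" where
  "initial w =
     (0, (\<lambda>i. if 0 \<le> i \<and> i < int (length w) then (if w ! nat i then 2 else 1) else 0), 0)"

definition accepts :: "tm \<Rightarrow> bool list \<Rightarrow> bool" where
  "accepts M w \<longleftrightarrow>
     (\<exists>c. (initial w, c) \<in> (step M)\<^sup>* \<and> c \<notin> Domain (step M) \<and> fst c = 1)"

definition poly_time :: "tm \<Rightarrow> bool" where
  "poly_time M \<longleftrightarrow>
     (\<exists>p :: nat poly. \<forall>w c n. (initial w, c) \<in> step M ^^ n \<longrightarrow> n \<le> poly p (length w))"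

definition deterministic :: "tm \<Rightarrow> bool" where
  "deterministic M \<longleftrightarrow> (\<forall>q a r r'. (q, a, r) \<in> M \<longrightarrow> (q, a, r') \<in> M \<longrightarrow> r = r')"

definition class_P :: "bool list set set" where
  "class_P = {{w. accepts M w} | M. finite M \<and> deterministic M \<and> poly_time M}"

definition class_NP :: "bool list set set" where
  "class_NP = {{w. accepts M w} | M. finite M \<and> poly_time M}"


section \<open>Routing games\<close>

text \<open>
  Vectors indexed by the arcs of \<open>G\<close> are extensional functions on \<^term>\<open>arcs G\<close>, so that
  \<^term>\<open>arcs G \<rightarrow>\<^sub>E {0::real..}\<close> is the nonnegative orthant of the arc space. Integral vectors
  are real vectors with entries in \<^term>\<open>\<int> :: real set\<close>.
\<close>

definition routing_instance ::
    "('v, 'e) pre_digraph \<Rightarrow> 'i set \<Rightarrow> ('i \<Rightarrow> 'v) \<Rightarrow> ('i \<Rightarrow> 'v) \<Rightarrow> bool" where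
  "routing_instance G N s t \<longleftrightarrow>
     digraph G \<and> finite N \<and> (\<forall>i\<in>N. s i \<in> verts G \<and> t i \<in> verts G)"

definition net_outflow :: "('v, 'e) pre_digraph \<Rightarrow> ('e \<Rightarrow> real) \<Rightarrow> 'v \<Rightarrow> real" where
  "net_outflow G x v = (\<Sum>j\<in>out_arcs G v. x j) - (\<Sum>j\<in>in_arcs G v. x j)"

definition flow_polyhedron :: "('v, 'e) pre_digraph \<Rightarrow> 'v \<Rightarrow> 'v \<Rightarrow> ('e \<Rightarrow> real) set" where
  "flow_polyhedron G s t =
     {x \<in> arcs G \<rightarrow>\<^sub>E {0..}. \<forall>v \<in> verts G - {s, t}. net_outflow G x v = 0}"

definition integral_flows :: "('v, 'e) pre_digraph \<Rightarrow> 'v \<Rightarrow> 'v \<Rightarrow> ('e \<Rightarrow> real) set" where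
  "integral_flows G s t = flow_polyhedron G s t \<inter> (arcs G \<rightarrow>\<^sub>E \<int>)"

text \<open>The value of a flow with source \<open>s\<close> is its net outflow at \<open>s\<close>.\<close>

abbreviation flow_val :: "('v, 'e) pre_digraph \<Rightarrow> 'v \<Rightarrow> ('e \<Rightarrow> real) \<Rightarrow> real" where
  "flow_val G s x \<equiv> net_outflow G x s"

definition capped_linear :: "(real \<Rightarrow> real) \<Rightarrow> bool" where
  "capped_linear f \<longleftrightarrow>
     (\<exists>a zmax. \<forall>z. (z \<le> zmax \<longrightarrow> f z = a * z) \<and> (z \<ge> zmax \<longrightarrow> f z = a * zmax))"

definition load :: "'i set \<Rightarrow> ('i \<Rightarrow> 'e \<Rightarrow> real) \<Rightarrow> 'e \<Rightarrow> real" where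
  "load N x j = (\<Sum>i\<in>N. x i j)"

text \<open>\<open>X i\<close> is the strategy space of player \<open>i\<close>, and \<open>p\<close> is the vector of prices.\<close>

definition weakly_enforceable_mcp ::
    "('v, 'e) pre_digraph \<Rightarrow> 'i set \<Rightarrow> ('i \<Rightarrow> 'v) \<Rightarrow> ('i \<Rightarrow> real \<Rightarrow> real) \<Rightarrow>
     ('i \<Rightarrow> ('e \<Rightarrow> real) set) \<Rightarrow> ('e \<Rightarrow> real) \<Rightarrow> bool" where
  "weakly_enforceable_mcp G N s U X u \<longleftrightarrow>
     (\<exists>x \<in> Pi\<^sub>E N X. \<exists>p \<in> arcs G \<rightarrow>\<^sub>E {0..}.
        (\<forall>j\<in>arcs G. load N x j \<le> u j) \<and>
        (\<forall>j\<in>arcs G. load N x j < u j \<longrightarrow> p j = 0) \<and>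
        (\<forall>i\<in>N. is_arg_max (\<lambda>y. U i (flow_val G (s i) y) - (\<Sum>j\<in>arcs G. p j * y j))
                  (\<lambda>y. y \<in> X i) (x i)))"

end

theory Submission
  imports Defs
begin

text \<open>
  The counterexample is explicit. Player 1 can route from 0 to 5 along either of the
  arc-disjoint paths 0-1-2-5 and 0-3-4-5; player 2 has only the path 1-2-3-4, which shares an arc with each of them.
  All capacities are 1 and \<open>U z = min z 1\<close>. Fractionally, half a unit on each of the three paths
  yields welfare 3/2. Clearing prices would let every player compare an equilibrium strategy with
  the average of two integral strategies, so the equilibrium would have welfare at least 3/2; by
  integrality both players would then send a full unit, which is impossible.
\<close>

text \<open>The two lists give the endpoints of arcs 0 to 6. Player 1's paths are the arc sets
  \<open>{0, 2, 5}\<close> and \<open>{1, 4, 6}\<close>, player 2's is \<open>{2, 3, 4}\<close>, so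
  the contested arcs are 2 and 4.\<close>

definition gap_graph :: "(nat, nat) pre_digraph" where
  "gap_graph = \<lparr>verts = {..<6}, arcs = {..<7},
     tail = (!) [0, 0, 1, 2, 3, 2, 4], head = (!) [1, 3, 2, 3, 4, 5, 5]\<rparr>"

lemma verts_gap_graph: "verts gap_graph = {0, 1, 2, 3, 4, 5}"
  by (auto simp: gap_graph_def)

lemma arcs_gap_graph: "arcs gap_graph = {0, 1, 2, 3, 4, 5, 6}"
  by (auto simp: gap_graph_def)

lemma digraph_gap_graph: "digraph gap_graph"
  by unfold_locales
    (auto simp: gap_graph_def arc_to_ends_def lessThan_nat_numeral lessThan_Suc)

lemma net_outflow_gap_graph:
  "net_outflow gap_graph x 0 = x 0 + x 1"
  "net_outflow gap_graph x 1 = x 2 - x 0"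
  "net_outflow gap_graph x 2 = x 3 + x 5 - x 2"
  "net_outflow gap_graph x 3 = x 4 - (x 1 + x 3)"
  "net_outflow gap_graph x 4 = x 6 - x 4"
  "net_outflow gap_graph x 5 = - (x 5 + x 6)"
proof -
  \<comment> \<open>Evaluates a filtered explicit set element by element, so that simp can decide
    each incidence separately.\<close>
  have insert_filter: "{e \<in> insert a A. P e} = (if P a then insert a else id) {e \<in> A. P e}"
    for a :: nat and A P by auto
  have "out_arcs gap_graph 0 = {0, 1}" "out_arcs gap_graph 1 = {2}"
    "out_arcs gap_graph 2 = {3, 5}" "out_arcs gap_graph 3 = {4}"
    "out_arcs gap_graph 4 = {6}" "out_arcs gap_graph 5 = {}"
    "in_arcs gap_graph 0 = {}" "in_arcs gap_graph 1 = {0}"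
    "in_arcs gap_graph 2 = {2}" "in_arcs gap_graph 3 = {1, 3}"
    "in_arcs gap_graph 4 = {4}" "in_arcs gap_graph 5 = {5, 6}"
    unfolding out_arcs_def in_arcs_def arcs_gap_graph insert_filter
    by (simp_all add: gap_graph_def)
  then show "net_outflow gap_graph x 0 = x 0 + x 1"
    "net_outflow gap_graph x 1 = x 2 - x 0"
    "net_outflow gap_graph x 2 = x 3 + x 5 - x 2"
    "net_outflow gap_graph x 3 = x 4 - (x 1 + x 3)"
    "net_outflow gap_graph x 4 = x 6 - x 4"
    "net_outflow gap_graph x 5 = - (x 5 + x 6)"
    by (simp_all add: net_outflow_def)
qed

abbreviation arc_indicator :: "nat set \<Rightarrow> nat \<Rightarrow> real" where
  "arc_indicator A \<equiv> (\<lambda>j\<in>arcs gap_graph. of_bool (j \<in> A))"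

text \<open>These are the deviations the equilibrium is tested against: both paths of player 1, and
  player 2's path and zero flow.\<close>

lemma gap_graph_flows:
  "arc_indicator {0, 2, 5} \<in> integral_flows gap_graph 0 5"
  "arc_indicator {1, 4, 6} \<in> integral_flows gap_graph 0 5"
  "arc_indicator {2, 3, 4} \<in> integral_flows gap_graph 1 4"
  "arc_indicator {} \<in> integral_flows gap_graph 1 4"
  by (auto simp: integral_flows_def flow_polyhedron_def verts_gap_graph
      net_outflow_gap_graph[simplified] arcs_gap_graph)

text \<open>Arcs 2 and 4 together cut 0 from 5, and an integral flow of positive value from 1 to 4
  fills both of them.\<close>

lemma gap_graph_no_two_units:
  assumes x: "x \<in> integral_flows gap_graph 0 5" and y: "y \<in> integral_flows gap_graph 1 4"
    and cap: "\<And>j. j \<in> arcs gap_graph \<Longrightarrow> x j + y j \<le> 1"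
    and val: "flow_val gap_graph 0 x > 0" "flow_val gap_graph 1 y > 0"
  shows False
proof -
  have int: "x j \<in> \<int>" "y j \<in> \<int>" and nonneg: "x j \<ge> 0" "y j \<ge> 0"
    if "j \<in> arcs gap_graph" for j
    using x y that by (auto simp: integral_flows_def flow_polyhedron_def PiE_def Pi_def)
  have conserved: "net_outflow gap_graph z v = 0"
    if "z \<in> integral_flows gap_graph a b" "v \<in> {0, 1, 2, 3, 4, 5} - {a, b}" for z a b v
    using that by (auto simp: integral_flows_def flow_polyhedron_def verts_gap_graph)
  have x_cons: "x 2 = x 0" "x 4 = x 1 + x 3"
    using conserved[OF x, of 1] conserved[OF x, of 3]
    by (simp_all add: net_outflow_gap_graph[simplified])
  have y_cons: "y 0 + y 1 = 0" "y 3 + y 5 = y 2" "y 4 = y 1 + y 3" "y 5 + y 6 = 0"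
    using conserved[OF y, of 0] conserved[OF y, of 2] conserved[OF y, of 3] conserved[OF y, of 5]
    by (simp_all add: net_outflow_gap_graph[simplified])
  have nn: "x j \<ge> 0" "y j \<ge> 0" if "j \<in> {0, 1, 2, 3, 4, 5, 6}" for j
    using nonneg that by (simp_all add: arcs_gap_graph)
  \<comment> \<open>No arc enters 0 or leaves 5, and player 2 must conserve flow at both, so the
    arcs there stay empty.\<close>
  have "y 0 = 0" "y 1 = 0" "y 5 = 0"
    using y_cons nn[of 0] nn[of 1] nn[of 5] nn[of 6] by auto
  moreover have "y 2 > 0"
    using val(2) \<open>y 0 = 0\<close> by (simp add: net_outflow_gap_graph[simplified])
  \<comment> \<open>Integrality enters here; with half units the two players could coexist.\<close>
  then have "y 2 \<ge> 1"
    using int(2)[of 2] by (auto simp: arcs_gap_graph elim!: Ints_cases)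
  ultimately have "y 4 \<ge> 1" using y_cons by simp
  have "x 2 \<le> 0" "x 4 \<le> 0"
    using cap[of 2] cap[of 4] \<open>y 2 \<ge> 1\<close> \<open>y 4 \<ge> 1\<close> by (auto simp: arcs_gap_graph)
  then have "x 0 \<le> 0" "x 1 \<le> 0"
    using x_cons nn(1)[of 3] by auto
  with val(1) show False by (simp add: net_outflow_gap_graph[simplified])
qed

text \<open>The prices act as a dual certificate: they would bound the welfare of the half-unit
  routing by that of the integral \<open>x\<close>.\<close>

lemma gap_graph_not_enforceable:
  fixes s t :: "nat \<Rightarrow> nat" and U :: "nat \<Rightarrow> real \<Rightarrow> real"
  assumes st: "s 1 = 0" "t 1 = 5" "s 2 = 1" "t 2 = 4"
    and U: "\<And>i z. U i z = min z 1"
  shows "\<not> weakly_enforceable_mcp gap_graph {1, 2} s U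
    (\<lambda>i. integral_flows gap_graph (s i) (t i)) (arc_indicator UNIV)"
proof
  assume "weakly_enforceable_mcp gap_graph {1, 2} s U
    (\<lambda>i. integral_flows gap_graph (s i) (t i)) (arc_indicator UNIV)"
  then obtain x p
    where x: "x \<in> (\<Pi>\<^sub>E i\<in>{1, 2}. integral_flows gap_graph (s i) (t i))"
      and p: "p \<in> arcs gap_graph \<rightarrow>\<^sub>E {0..}"
      and cap: "\<forall>j\<in>arcs gap_graph. load {1, 2} x j \<le> arc_indicator UNIV j"
      and clear: "\<forall>j\<in>arcs gap_graph. load {1, 2} x j < arc_indicator UNIV j \<longrightarrow> p j = 0"
      and opt: "\<forall>i\<in>{1, 2}. is_arg_max
        (\<lambda>y. U i (flow_val gap_graph (s i) y) - (\<Sum>j\<in>arcs gap_graph. p j * y j))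
        (\<lambda>y. y \<in> integral_flows gap_graph (s i) (t i)) (x i)"
    unfolding weakly_enforceable_mcp_def by blast
  have x1: "x 1 \<in> integral_flows gap_graph 0 5" and x2: "x 2 \<in> integral_flows gap_graph 1 4"
    using PiE_mem[OF x, of 1] PiE_mem[OF x, of 2] st by simp_all
  define V where "V v y = min (flow_val gap_graph v y) 1 - (\<Sum>j\<in>arcs gap_graph. p j * y j)"
    for v y
  have opt1: "V 0 y \<le> V 0 (x 1)" if "y \<in> integral_flows gap_graph 0 5" for y
    using opt that st by (auto simp: is_arg_max_linorder U V_def)
  have opt2: "V 1 y \<le> V 1 (x 2)" if "y \<in> integral_flows gap_graph 1 4" for y
    using opt that st by (auto simp: is_arg_max_linorder U V_def)
  have p_nn: "p j \<ge> 0" if "j \<in> {0, 1, 2, 3, 4, 5, 6}" for j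
    using PiE_mem[OF p] that by (simp add: arcs_gap_graph)
  have "1 - (p 0 + p 2 + p 5) \<le> V 0 (x 1)" "1 - (p 1 + p 4 + p 6) \<le> V 0 (x 1)"
    "1 - (p 2 + p 3 + p 4) \<le> V 1 (x 2)" "0 \<le> V 1 (x 2)"
    using opt1[OF gap_graph_flows(1)] opt1[OF gap_graph_flows(2)]
      opt2[OF gap_graph_flows(3)] opt2[OF gap_graph_flows(4)]
    by (auto simp: V_def net_outflow_gap_graph[simplified] arcs_gap_graph)
  \<comment> \<open>Average the two bounds of each player and add. The averaged strategies load arcs
    2 and 4 fully and the others by one half, which is where nonnegative prices are needed.\<close>
  then have "3 / 2 - (\<Sum>j\<in>arcs gap_graph. p j) \<le> V 0 (x 1) + V 1 (x 2)"
    using p_nn[of 0] p_nn[of 1] p_nn[of 3] p_nn[of 5] p_nn[of 6] by (simp add: arcs_gap_graph)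
  \<comment> \<open>Complementary slackness: each arc is either full or free, so total payments
    equal the price of all unit capacities.\<close>
  moreover have "(\<Sum>j\<in>arcs gap_graph. p j * x 1 j) + (\<Sum>j\<in>arcs gap_graph. p j * x 2 j)
      = (\<Sum>j\<in>arcs gap_graph. p j)"
  proof -
    have "p j * x 1 j + p j * x 2 j = p j" if "j \<in> arcs gap_graph" for j
    proof (cases "x 1 j + x 2 j < 1")
      case True
      then show ?thesis using clear that by (auto simp: load_def)
    next
      case False
      then have "x 1 j + x 2 j = 1" using cap that by (force simp: load_def)
      then show ?thesis by (metis distrib_left mult.right_neutral)
    qed
    then show ?thesis by (simp flip: sum.distrib)
  qed
  ultimately have "min (flow_val gap_graph 0 (x 1)) 1 + min (flow_val gap_graph 1 (x 2)) 1 \<ge> 3 / 2"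
    by (simp add: V_def)
  \<comment> \<open>Each capped utility is at most 1, so both are at least 1/2.\<close>
  then have "flow_val gap_graph 0 (x 1) > 0" "flow_val gap_graph 1 (x 2) > 0"
    by (auto simp: min_def split: if_splits)
  with gap_graph_no_two_units[OF x1 x2] cap show False
    by (auto simp: load_def)
qed

theorem proposition9p4:
  assumes "class_P \<noteq> class_NP"
  shows "\<exists>(G :: (nat, nat) pre_digraph) (s :: nat \<Rightarrow> nat) (t :: nat \<Rightarrow> nat)
           (U :: nat \<Rightarrow> real \<Rightarrow> real).
           routing_instance G {1, 2} s t \<and>
           (s 1, t 1) \<noteq> (s 2, t 2) \<and>
           U 1 = U 2 \<and>
           (\<forall>i\<in>{1, 2}. mono (U i) \<and> capped_linear (U i)) \<and>
           (\<exists>u \<in> arcs G \<rightarrow>\<^sub>E (\<int> \<inter> {0..}).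
              \<not> weakly_enforceable_mcp G {1, 2} s U (\<lambda>i. integral_flows G (s i) (t i)) u)"
proof -
  define s t :: "nat \<Rightarrow> nat" where "s i = (if i = 1 then 0 else 1)"
    and "t i = (if i = 1 then 5 else 4)" for i
  define U :: "nat \<Rightarrow> real \<Rightarrow> real" where "U i z = min z 1" for i z
  have "routing_instance gap_graph {1, 2} s t"
    by (auto simp: routing_instance_def digraph_gap_graph verts_gap_graph s_def t_def)
  moreover have "(s 1, t 1) \<noteq> (s 2, t 2)" by (simp add: s_def)
  moreover have "U 1 = U 2" by (simp add: fun_eq_iff U_def)
  moreover have "mono (U i)" for i by (auto simp: mono_def U_def)
  moreover have "capped_linear (U i)" for i
    \<comment> \<open>Slope and cap are both 1.\<close>
    unfolding capped_linear_def by (intro exI[of _ 1]) (simp add: U_def min_def)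
  moreover have "arc_indicator UNIV \<in> arcs gap_graph \<rightarrow>\<^sub>E (\<int> \<inter> {0..})"
    by auto
  moreover have "\<not> weakly_enforceable_mcp gap_graph {1, 2} s U
      (\<lambda>i. integral_flows gap_graph (s i) (t i)) (arc_indicator UNIV)"
    by (rule gap_graph_not_enforceable) (simp_all add: s_def t_def U_def)
  ultimately show ?thesis by blast
qed

end
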